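(* Let $M$ be a connected closed manifold, $L:TM\to\mathbb{R}$ a time-independent Tonelli Lagrangian whose Mañé critical value is $c[0]=0$, $u^-:M\to\mathbb{R}$ a weak KAM solution, and let the cost function be $c=h$, where $h$ is the Peierls' barrier. If no static class is a singleton, then $\mathrm{Sing}^c(u^-)=M$.
   Context: Tonelli Lagrangian (time-independent): $L:TM\to\mathbb{R}$ is $C^2$, $v\mapsto L(x,v)$ is strictly convex for every $x$, and there are a superlinear function $\theta:[0,\infty)\to[0,\infty)$ and a constant $c_0\ge 0$ with $L(x,v)\ge\theta(|v|_x)-c_0$. For $t>0$ let $h(0,t,x,y):=\inf_{\gamma}\int_{0}^{t}L(\gamma(s),\dot\gamma(s))\,ds$, the infimum over absolutely continuous $\gamma:[0,t]\to M$ with $\gamma(0)=x$, $\gamma(t)=y$. The Peierls' barrier is $h(x,y)=\liminf_{t\to\infty}\big(h(0,t,x,y)+c[0]t\big)$, where $c[0]$ is the Mañé critical value of $L$ (the unique constant for which this liminf is finite); here $c[0]=0$. A weak KAM solution is a (continuous) function $u^-:M\to\mathbb{R}$ with $u^-(x)=\inf_{y\in M}\{u^-(y)+h(0,t,y,x)\}$ for all $t>0$, $x\in M$ (recall $c[0]=0$). The projected Aubry set is $\mathcal{A}=\{x\in M: h(x,x)=0\}$. On $\mathcal{A}$, $d(x,y)=h(x,y)+h(y,x)$ is a pseudo-distance; the equivalence classes of the relation $d(x,y)=0$ on $\mathcal A$ are called static classes. For the cost $c=h$: $\partial^cu^-(y):=\{x\in M:\ u^-(\cdot)-h(x,\cdot)\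 \text{attains its maximum at}\ y\}$, and $\mathrm{Sing}^c(u^-)$ is the set of $y\in M$ such that $\partial^cu^-(y)$ is not a singleton. *)

theory Defs
  imports "HOL-Analysis.Analysis"
begin

section \<open>Maps of class \<open>C^k\<close> on open sets\<close>

text \<open>In finite dimension, continuity of all iterated directional derivatives is the same as
  continuity of the iterated Frechet derivatives.\<close>

primrec Ck_on :: "nat \<Rightarrow> ('a::real_normed_vector \<Rightarrow> 'b::real_normed_vector) \<Rightarrow> 'a set \<Rightarrow> bool" where
  "Ck_on 0 f S \<longleftrightarrow> continuous_on S f"
| "Ck_on (Suc k) f S \<longleftrightarrow>
     (\<forall>x\<in>S. f differentiable (at x)) \<and>
     (\<forall>v. Ck_on k (\<lambda>x. frechet_derivative f (at x) v) S)"

definition smooth_on :: "('a::real_normed_vector \<Rightarrow> 'b::real_normed_vector) \<Rightarrow> 'a set \<Rightarrow> bool" where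
  "smooth_on f S \<longleftrightarrow> (\<forall>k. Ck_on k f S)"


section \<open>Smooth manifolds, tangent vectors, Riemannian metrics\<close>

text \<open>A manifold is a topological type \<open>'m\<close> with an atlas of charts onto open subsets of a
  Euclidean space \<open>'e\<close>. A chart is its domain paired with the coordinate map, which is
  meaningful on the domain only.\<close>

type_synonym ('m, 'e) chart = "'m set \<times> ('m \<Rightarrow> 'e)"

abbreviation chart_inv :: "('m, 'e) chart \<Rightarrow> 'e \<Rightarrow> 'm" where
  "chart_inv \<phi> \<equiv> inv_into (fst \<phi>) (snd \<phi>)"

definition is_chart :: "('m::topological_space, 'e::euclidean_space) chart \<Rightarrow> bool" where
  "is_chart \<phi> \<longleftrightarrow> open (fst \<phi>) \<and> open (snd \<phi> ` fst \<phi>) \<and>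
     homeomorphism (fst \<phi>) (snd \<phi> ` fst \<phi>) (snd \<phi>) (chart_inv \<phi>)"

definition smooth_atlas ::
    "('m::{t2_space, second_countable_topology}, 'e::euclidean_space) chart set \<Rightarrow> bool" where
  "smooth_atlas A \<longleftrightarrow> (\<forall>\<phi>\<in>A. is_chart \<phi>) \<and> (\<Union>\<phi>\<in>A. fst \<phi>) = UNIV \<and>
     (\<forall>\<phi>\<in>A. \<forall>\<psi>\<in>A. smooth_on (snd \<psi> \<circ> chart_inv \<phi>) (snd \<phi> ` (fst \<phi> \<inter> fst \<psi>)))"

definition closed_connected_manifold ::
    "('m::{t2_space, second_countable_topology}, 'e::euclidean_space) chart set \<Rightarrow> bool" where
  "closed_connected_manifold A \<longleftrightarrow>
     smooth_atlas A \<and> compact (UNIV :: 'm set) \<and> connected (UNIV :: 'm set)"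

text \<open>A tangent vector at \<open>x\<close> is the family of its coordinate vectors in the charts around
  \<open>x\<close>, transforming by the derivatives of the transition maps (and set to 0 at all other
  indices, so that equality of functions is equality of vectors). The vector space operations
  are pointwise.\<close>

type_synonym ('m, 'e) tangent = "('m, 'e) chart \<Rightarrow> 'e"

definition tangent_space ::
    "('m, 'e::euclidean_space) chart set \<Rightarrow> 'm \<Rightarrow> ('m, 'e) tangent set" where
  "tangent_space A x = {v.
     (\<forall>\<phi>\<in>A. \<forall>\<psi>\<in>A. x \<in> fst \<phi> \<inter> fst \<psi> \<longrightarrow>
        v \<psi> = frechet_derivative (snd \<psi> \<circ> chart_inv \<phi>) (at (snd \<phi> x)) (v \<phi>)) \<and>
     (\<forall>\<phi>. \<not> (\<phi> \<in> A \<and> x \<in> fst \<phi>) \<longrightarrow> v \<phi> = 0)}"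

definition lin_comb :: "real \<Rightarrow> ('m, 'e::real_vector) tangent \<Rightarrow> real \<Rightarrow> ('m, 'e) tangent \<Rightarrow> ('m, 'e) tangent"
  where "lin_comb a v b w = (\<lambda>\<phi>. a *\<^sub>R v \<phi> + b *\<^sub>R w \<phi>)"

text \<open>The tangent vector at \<open>x\<close> whose coordinate vector in the chart \<open>\<phi>\<close> is \<open>w\<close>.\<close>

definition of_coords ::
    "('m, 'e::euclidean_space) chart set \<Rightarrow> ('m, 'e) chart \<Rightarrow> 'm \<Rightarrow> 'e \<Rightarrow> ('m, 'e) tangent" where
  "of_coords A \<phi> x w = (\<lambda>\<psi>. if \<psi> \<in> A \<and> x \<in> fst \<psi>
     then frechet_derivative (snd \<psi> \<circ> chart_inv \<phi>) (at (snd \<phi> x)) w else 0)"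

definition riemannian_metric ::
    "('m, 'e::euclidean_space) chart set \<Rightarrow> ('m \<Rightarrow> ('m, 'e) tangent \<Rightarrow> ('m, 'e) tangent \<Rightarrow> real) \<Rightarrow> bool"
  where
  "riemannian_metric A g \<longleftrightarrow>
     (\<forall>x. \<forall>v\<in>tangent_space A x. \<forall>w\<in>tangent_space A x. g x v w = g x w v) \<and>
     (\<forall>x. \<forall>v\<in>tangent_space A x. \<forall>w\<in>tangent_space A x. \<forall>z\<in>tangent_space A x. \<forall>a b.
        g x (lin_comb a v b w) z = a * g x v z + b * g x w z) \<and>
     (\<forall>x. \<forall>v\<in>tangent_space A x. v \<noteq> (\<lambda>_. 0) \<longrightarrow> g x v v > 0) \<and>
     (\<forall>\<phi>\<in>A. \<forall>a b. smooth_on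
        (\<lambda>p. g (chart_inv \<phi> p) (of_coords A \<phi> (chart_inv \<phi> p) a) (of_coords A \<phi> (chart_inv \<phi> p) b))
        (snd \<phi> ` fst \<phi>))"

definition riem_norm ::
    "('m \<Rightarrow> ('m, 'e) tangent \<Rightarrow> ('m, 'e) tangent \<Rightarrow> real) \<Rightarrow> 'm \<Rightarrow> ('m, 'e) tangent \<Rightarrow> real" where
  "riem_norm g x v = sqrt (g x v v)"


section \<open>Tonelli Lagrangians and the action\<close>

text \<open>A function on the tangent bundle is given as \<open>L x v\<close>, of which only the values at
  \<open>v \<in> tangent_space A x\<close> matter.\<close>

definition tonelli_lagrangian ::
    "('m, 'e::euclidean_space) chart set \<Rightarrow> ('m \<Rightarrow> ('m, 'e) tangent \<Rightarrow> ('m, 'e) tangent \<Rightarrow> real) \<Rightarrow>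
     ('m \<Rightarrow> ('m, 'e) tangent \<Rightarrow> real) \<Rightarrow> bool" where
  "tonelli_lagrangian A g L \<longleftrightarrow>
     (\<forall>\<phi>\<in>A. Ck_on 2 (\<lambda>(p, w). L (chart_inv \<phi> p) (of_coords A \<phi> (chart_inv \<phi> p) w))
        ((snd \<phi> ` fst \<phi>) \<times> UNIV)) \<and>
     (\<forall>x. \<forall>v\<in>tangent_space A x. \<forall>w\<in>tangent_space A x. \<forall>r\<in>{0<..<1}. v \<noteq> w \<longrightarrow>
        L x (lin_comb (1 - r) v r w) < (1 - r) * L x v + r * L x w) \<and>
     (\<exists>(\<theta> :: real \<Rightarrow> real) c0.
        (\<forall>r\<ge>0. \<theta> r \<ge> 0) \<and> filterlim (\<lambda>r. \<theta> r / r) at_top at_top \<and> c0 \<ge> 0 \<and>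
        (\<forall>x. \<forall>v\<in>tangent_space A x. L x v \<ge> \<theta> (riem_norm g x v) - c0))"

text \<open>The usual \<open>\<epsilon>\<close>-\<open>\<delta>\<close> definition: \<open>D\<close> ranges over the finite families of
  non-overlapping compact intervals contained in \<open>S\<close>.\<close>

definition abs_continuous_on :: "real set \<Rightarrow> (real \<Rightarrow> 'e::real_normed_vector) \<Rightarrow> bool" where
  "abs_continuous_on S f \<longleftrightarrow>
     (\<forall>\<epsilon>>0. \<exists>\<delta>>0. \<forall>D T. D division_of T \<longrightarrow> T \<subseteq> S \<longrightarrow> (\<Sum>I\<in>D. Sup I - Inf I) < \<delta> \<longrightarrow>
        (\<Sum>I\<in>D. norm (f (Sup I) - f (Inf I))) < \<epsilon>)"

definition abs_continuous_curve ::
    "('m::topological_space, 'e::euclidean_space) chart set \<Rightarrow> real \<Rightarrow> (real \<Rightarrow> 'm) \<Rightarrow> bool" where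
  "abs_continuous_curve A t \<gamma> \<longleftrightarrow> continuous_on {0..t} \<gamma> \<and>
     (\<forall>\<phi>\<in>A. \<forall>a b. 0 \<le> a \<longrightarrow> a \<le> b \<longrightarrow> b \<le> t \<longrightarrow> \<gamma> ` {a..b} \<subseteq> fst \<phi> \<longrightarrow>
        abs_continuous_on {a..b} (snd \<phi> \<circ> \<gamma>))"

text \<open>For an absolutely continuous curve this is a tangent vector at \<open>\<gamma> s\<close> for almost every
  \<open>s\<close>, and arbitrary on the remaining null set.\<close>

definition velocity ::
    "('m, 'e::euclidean_space) chart set \<Rightarrow> (real \<Rightarrow> 'm) \<Rightarrow> real \<Rightarrow> ('m, 'e) tangent" where
  "velocity A \<gamma> s = (\<lambda>\<phi>. if \<phi> \<in> A \<and> \<gamma> s \<in> fst \<phi>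
     then vector_derivative (snd \<phi> \<circ> \<gamma>) (at s) else 0)"

text \<open>A Tonelli Lagrangian is bounded below, so the integral of \<open>L(\<gamma>, \<gamma>')\<close> always exists in
  \<open>(-\<infinity>, \<infinity>]\<close>, and it is \<open>\<infinity>\<close> exactly when the integrand is not Lebesgue integrable.\<close>

definition action ::
    "('m, 'e::euclidean_space) chart set \<Rightarrow> ('m \<Rightarrow> ('m, 'e) tangent \<Rightarrow> real) \<Rightarrow> real \<Rightarrow> (real \<Rightarrow> 'm) \<Rightarrow> ereal"
  where
  "action A L t \<gamma> =
     (if (\<lambda>s. L (\<gamma> s) (velocity A \<gamma> s)) absolutely_integrable_on {0..t}
      then ereal (integral {0..t} (\<lambda>s. L (\<gamma> s) (velocity A \<gamma> s))) else \<infinity>)"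

definition minimal_action ::
    "('m::topological_space, 'e::euclidean_space) chart set \<Rightarrow> ('m \<Rightarrow> ('m, 'e) tangent \<Rightarrow> real) \<Rightarrow>
     real \<Rightarrow> 'm \<Rightarrow> 'm \<Rightarrow> ereal" where
  "minimal_action A L t x y =
     (INF \<gamma>\<in>{\<gamma>. abs_continuous_curve A t \<gamma> \<and> \<gamma> 0 = x \<and> \<gamma> t = y}. action A L t \<gamma>)"


section \<open>Weak KAM theory\<close>

text \<open>The parameter \<open>c\<close> stands for the critical value \<open>c[0]\<close>.\<close>

definition peierls_barrier ::
    "('m::topological_space, 'e::euclidean_space) chart set \<Rightarrow> ('m \<Rightarrow> ('m, 'e) tangent \<Rightarrow> real) \<Rightarrow>
     real \<Rightarrow> 'm \<Rightarrow> 'm \<Rightarrow> ereal" where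
  "peierls_barrier A L c x y =
     Liminf at_top (\<lambda>t::real. minimal_action A L t x y + ereal (c * t))"

definition is_mane_critical_value ::
    "('m::topological_space, 'e::euclidean_space) chart set \<Rightarrow> ('m \<Rightarrow> ('m, 'e) tangent \<Rightarrow> real) \<Rightarrow>
     real \<Rightarrow> bool" where
  "is_mane_critical_value A L c \<longleftrightarrow>
     (\<forall>c'. (\<forall>x y. \<bar>peierls_barrier A L c' x y\<bar> \<noteq> \<infinity>) \<longleftrightarrow> c' = c)"

text \<open>The equation below is the one for critical value 0.\<close>

definition weak_KAM_solution ::
    "('m::topological_space, 'e::euclidean_space) chart set \<Rightarrow> ('m \<Rightarrow> ('m, 'e) tangent \<Rightarrow> real) \<Rightarrow>
     ('m \<Rightarrow> real) \<Rightarrow> bool" where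
  "weak_KAM_solution A L u \<longleftrightarrow> continuous_on UNIV u \<and>
     (\<forall>t>0. \<forall>x. ereal (u x) = (INF y. ereal (u y) + minimal_action A L t y x))"

definition projected_aubry_set :: "('m \<Rightarrow> 'm \<Rightarrow> ereal) \<Rightarrow> 'm set" where
  "projected_aubry_set h = {x. h x x = 0}"

definition static_classes :: "('m \<Rightarrow> 'm \<Rightarrow> ereal) \<Rightarrow> 'm set set" where
  "static_classes h = projected_aubry_set h //
     {(x, y). x \<in> projected_aubry_set h \<and> y \<in> projected_aubry_set h \<and> h x y + h y x = 0}"

definition c_superdifferential :: "('m \<Rightarrow> 'm \<Rightarrow> ereal) \<Rightarrow> ('m \<Rightarrow> real) \<Rightarrow> 'm \<Rightarrow> 'm set" where
  "c_superdifferential c u y = {x. \<forall>z. ereal (u z) - c x z \<le> ereal (u y) - c x y}"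

definition Sing_c :: "('m \<Rightarrow> 'm \<Rightarrow> ereal) \<Rightarrow> ('m \<Rightarrow> real) \<Rightarrow> 'm set" where
  "Sing_c c u = {y. \<not> is_singleton (c_superdifferential c u y)}"

end

theory Submission
  imports Defs
begin

text \<open>Let \<open>h\<close> be the Peierls barrier. Cutting almost minimizing curves in the middle and using
  compactness shows that \<open>h x y = h x a + h a y\<close> for some \<open>a\<close>, and iterating this gives such an
  \<open>a\<close> in the Aubry set. If \<open>x\<close> lies in the superdifferential of \<open>u\<close> at \<open>y\<close>, then so does this
  \<open>a\<close>, by the triangle inequality, and it differs from \<open>x\<close> unless \<open>x\<close> is in the Aubry set. In that
  case the static class of \<open>x\<close> contains some \<open>b \<noteq> x\<close>; the functions \<open>h x\<close> and \<open>h b\<close> differ by a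
  constant, so \<open>b\<close> lies in the superdifferential as well.\<close>

subsection \<open>Absolutely continuous functions\<close>

lemma division_of_real_interval:
  fixes I :: "real set"
  assumes "D division_of T" "I \<in> D"
  shows "Inf I \<le> Sup I" "I = {Inf I..Sup I}" "Inf I \<in> T" "Sup I \<in> T"
proof -
  obtain a b where "I = cbox a b" "I \<noteq> {}" "I \<subseteq> T"
    using division_ofD(2-4)[OF assms] by blast
  then show "Inf I \<le> Sup I" "I = {Inf I..Sup I}" "Inf I \<in> T" "Sup I \<in> T" by auto
qed

lemma abs_continuous_on_cong:
  assumes eq: "\<And>x. x \<in> S \<Longrightarrow> f x = g x"
  shows "abs_continuous_on S f \<longleftrightarrow> abs_continuous_on S g"
proof -
  have "(\<Sum>I\<in>D. norm (f (Sup I) - f (Inf I))) = (\<Sum>I\<in>D. norm (g (Sup I) - g (Inf I)))"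
    if "D division_of T" "T \<subseteq> S" for D T
    using division_of_real_interval(3,4)[OF that(1)] that(2)
    by (intro sum.cong) (simp_all add: eq subset_iff)
  then show ?thesis unfolding abs_continuous_on_def by (metis (no_types, lifting))
qed

lemma lipschitz_imp_abs_continuous_on:
  fixes f :: "real \<Rightarrow> 'e::real_normed_vector"
  assumes lip: "\<And>x y. x \<in> S \<Longrightarrow> y \<in> S \<Longrightarrow> norm (f x - f y) \<le> C * \<bar>x - y\<bar>"
  shows "abs_continuous_on S f"
  unfolding abs_continuous_on_def
proof (intro allI impI)
  fix \<epsilon> :: real assume "\<epsilon> > 0"
  show "\<exists>\<delta>>0. \<forall>D T. D division_of T \<longrightarrow> T \<subseteq> S \<longrightarrow> (\<Sum>I\<in>D. Sup I - Inf I) < \<delta> \<longrightarrow>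
        (\<Sum>I\<in>D. norm (f (Sup I) - f (Inf I))) < \<epsilon>"
  \<comment> \<open>\<open>\<bar>C\<bar> + 1\<close> in place of \<open>C\<close> keeps the divisor
    positive, whatever the sign of \<open>C\<close>.\<close>
  proof (intro exI[of _ "\<epsilon> / (\<bar>C\<bar> + 1)"] conjI allI impI)
    show "0 < \<epsilon> / (\<bar>C\<bar> + 1)" using \<open>\<epsilon> > 0\<close> by simp
    fix D T
    assume D: "D division_of T" "T \<subseteq> S" and small: "(\<Sum>I\<in>D. Sup I - Inf I) < \<epsilon> / (\<bar>C\<bar> + 1)"
    have "norm (f (Sup I) - f (Inf I)) \<le> (\<bar>C\<bar> + 1) * (Sup I - Inf I)" if "I \<in> D" for I
    proof -
      note I = division_of_real_interval[OF D(1) that]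
      have "norm (f (Sup I) - f (Inf I)) \<le> C * (Sup I - Inf I)"
        using lip[of "Sup I" "Inf I"] I D(2) by auto
      also have "\<dots> \<le> (\<bar>C\<bar> + 1) * (Sup I - Inf I)"
        using I(1) by (intro mult_right_mono) auto
      finally show ?thesis .
    qed
    then have "(\<Sum>I\<in>D. norm (f (Sup I) - f (Inf I))) \<le> (\<bar>C\<bar> + 1) * (\<Sum>I\<in>D. Sup I - Inf I)"
      unfolding sum_distrib_left by (rule sum_mono)
    also have "\<dots> < \<epsilon>" using small by (simp add: field_simps)
    finally show "(\<Sum>I\<in>D. norm (f (Sup I) - f (Inf I))) < \<epsilon>" .
  qed
qed

lemma division_of_translation:
  fixes c :: "'a::euclidean_space"
  assumes D: "D division_of T"
  shows "image ((+) c) ` D division_of ((+) c ` T)"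
proof (rule division_ofI)
  show "finite (image ((+) c) ` D)" using D by auto
next
  fix K assume "K \<in> image ((+) c) ` D"
  then obtain I where I: "I \<in> D" "K = (+) c ` I" by auto
  obtain a b where "I = cbox a b" "I \<noteq> {}" "I \<subseteq> T"
    using division_ofD(2-4)[OF D I(1)] by blast
  with I show "K \<subseteq> (+) c ` T" "K \<noteq> {}" "\<exists>a b. K = cbox a b"
    using cbox_translation[of c a b, symmetric] by auto
next
  fix K K' assume "K \<in> image ((+) c) ` D" "K' \<in> image ((+) c) ` D" "K \<noteq> K'"
  then obtain I J where IJ: "I \<in> D" "K = (+) c ` I" "J \<in> D" "K' = (+) c ` J" "I \<noteq> J" by auto
  with D have "interior I \<inter> interior J = {}" by auto
  with IJ show "interior K \<inter> interior K' = {}"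
    by (auto simp: interior_translation)
next
  show "\<Union> (image ((+) c) ` D) = (+) c ` T"
    using division_ofD(6)[OF D] by (simp add: image_Union[symmetric])
qed

text \<open>Translation carries divisions to divisions and keeps the length of every cell, so the
  same \<open>\<delta>\<close> serves.\<close>

lemma abs_continuous_on_shift:
  fixes c :: real
  assumes "abs_continuous_on ((+) c ` S) f"
  shows "abs_continuous_on S (\<lambda>x. f (c + x))"
  unfolding abs_continuous_on_def
proof (intro allI impI)
  fix \<epsilon> :: real assume "\<epsilon> > 0"
  with assms obtain \<delta> where "\<delta> > 0" and
    \<delta>: "\<And>D T. D division_of T \<Longrightarrow> T \<subseteq> (+) c ` S \<Longrightarrow> (\<Sum>I\<in>D. Sup I - Inf I) < \<delta> \<Longrightarrow>
        (\<Sum>I\<in>D. norm (f (Sup I) - f (Inf I))) < \<epsilon>"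
    unfolding abs_continuous_on_def by meson
  show "\<exists>\<delta>>0. \<forall>D T. D division_of T \<longrightarrow> T \<subseteq> S \<longrightarrow> (\<Sum>I\<in>D. Sup I - Inf I) < \<delta> \<longrightarrow>
        (\<Sum>I\<in>D. norm (f (c + Sup I) - f (c + Inf I))) < \<epsilon>"
  proof (intro exI[of _ \<delta>] conjI allI impI \<open>\<delta> > 0\<close>)
    fix D T
    assume D: "D division_of T" "T \<subseteq> S" and small: "(\<Sum>I\<in>D. Sup I - Inf I) < \<delta>"
    \<comment> \<open>Distinct cells have distinct translates, so no term is lost when sums over the
      translated division are reindexed.\<close>
    have inj: "inj_on (image ((+) c)) D"
      by (rule inj_onI) (auto simp: inj_image_eq_iff)
    have ends: "Sup ((+) c ` I) = c + Sup I" "Inf ((+) c ` I) = c + Inf I" if "I \<in> D" for I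
    proof -
      obtain p q where I: "I = {p..q}" "p \<le> q"
        using division_of_real_interval(1,2)[OF D(1) \<open>I \<in> D\<close>] by metis
      have "(+) c ` {p..q} = {c + p..c + q}" by (simp add: add.commute)
      with I show "Sup ((+) c ` I) = c + Sup I" "Inf ((+) c ` I) = c + Inf I"
        by simp_all
    qed
    have "(\<Sum>I\<in>image ((+) c) ` D. norm (f (Sup I) - f (Inf I))) < \<epsilon>"
    proof (rule \<delta>)
      show "image ((+) c) ` D division_of ((+) c ` T)"
        by (rule division_of_translation[OF D(1)])
      show "(+) c ` T \<subseteq> (+) c ` S" using D(2) by auto
      show "(\<Sum>I\<in>image ((+) c) ` D. Sup I - Inf I) < \<delta>"
        using small by (simp add: sum.reindex[OF inj] ends)
    qed
    then show "(\<Sum>I\<in>D. norm (f (c + Sup I) - f (c + Inf I))) < \<epsilon>"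
      by (simp add: sum.reindex[OF inj] ends)
  qed
qed

text \<open>At most one cell of a division contains \<open>c\<close> in its interior. The other
  cells fall under one of the two hypotheses, and the exceptional one is cut at
  \<open>c\<close>.\<close>

lemma abs_continuous_on_join:
  fixes f :: "real \<Rightarrow> 'e::real_normed_vector"
  assumes "abs_continuous_on {a..c} f" "abs_continuous_on {c..b} f"
  shows "abs_continuous_on {a..b} f"
  unfolding abs_continuous_on_def
proof (intro allI impI)
  fix \<epsilon> :: real assume "\<epsilon> > 0"
  then have "\<epsilon>/4 > 0" by simp
  with assms(1) obtain \<delta>1 where "\<delta>1 > 0" and
    \<delta>1: "\<And>D T. D division_of T \<Longrightarrow> T \<subseteq> {a..c} \<Longrightarrow> (\<Sum>I\<in>D. Sup I - Inf I) < \<delta>1 \<Longrightarrow>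
        (\<Sum>I\<in>D. norm (f (Sup I) - f (Inf I))) < \<epsilon>/4"
    unfolding abs_continuous_on_def by meson
  from assms(2) \<open>\<epsilon>/4 > 0\<close> obtain \<delta>2 where "\<delta>2 > 0" and
    \<delta>2: "\<And>D T. D division_of T \<Longrightarrow> T \<subseteq> {c..b} \<Longrightarrow> (\<Sum>I\<in>D. Sup I - Inf I) < \<delta>2 \<Longrightarrow>
        (\<Sum>I\<in>D. norm (f (Sup I) - f (Inf I))) < \<epsilon>/4"
    unfolding abs_continuous_on_def by meson
  show "\<exists>\<delta>>0. \<forall>D T. D division_of T \<longrightarrow> T \<subseteq> {a..b} \<longrightarrow> (\<Sum>I\<in>D. Sup I - Inf I) < \<delta> \<longrightarrow>
        (\<Sum>I\<in>D. norm (f (Sup I) - f (Inf I))) < \<epsilon>"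
  proof (intro exI[of _ "min \<delta>1 \<delta>2"] conjI allI impI)
    show "0 < min \<delta>1 \<delta>2" using \<open>\<delta>1 > 0\<close> \<open>\<delta>2 > 0\<close> by simp
    fix D T
    assume D: "D division_of T" "T \<subseteq> {a..b}" and small: "(\<Sum>I\<in>D. Sup I - Inf I) < min \<delta>1 \<delta>2"
    note I = division_of_real_interval[OF D(1)]
    have fin: "finite D" and D': "D division_of \<Union>D" using D(1) by auto
    have len: "(\<Sum>I\<in>E. Sup I - Inf I) < min \<delta>1 \<delta>2" if "E \<subseteq> D" for E
      using small sum_mono2[OF fin that, of "\<lambda>I. Sup I - Inf I"] I(1) by force
    \<comment> \<open>A degenerate cell \<open>{c}\<close> satisfies both
      \<open>Sup I \<le> c\<close> and \<open>c \<le> Inf I\<close>; the clause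
      \<open>c < Sup I\<close> puts it into \<open>D1\<close> only.\<close>
    define D1 D2 D3 where "D1 = {I\<in>D. Sup I \<le> c}" and "D2 = {I\<in>D. c < Sup I \<and> c \<le> Inf I}"
      and "D3 = {I\<in>D. Inf I < c \<and> c < Sup I}"
    have D_split: "D = D1 \<union> (D2 \<union> D3)" "D1 \<inter> (D2 \<union> D3) = {}" "D2 \<inter> D3 = {}"
      by (auto simp: D1_def D2_def D3_def)
    have mem: "a \<le> Inf I" "Sup I \<le> b" if "I \<in> D" for I
      using I(3,4)[OF that] D(2) by auto
    have "(\<Sum>I\<in>D1. norm (f (Sup I) - f (Inf I))) < \<epsilon>/4"
    proof (rule \<delta>1)
      show "D1 division_of \<Union>D1" by (rule division_of_subset[OF D']) (auto simp: D1_def)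
      have "K \<subseteq> {a..c}" if "K \<in> D1" for K
      proof -
        have "K \<in> D" using that by (simp add: D1_def)
        have "{Inf K..Sup K} \<subseteq> {a..c}" using mem[of K] that by (auto simp: D1_def)
        with equalityD1[OF I(2)[OF \<open>K \<in> D\<close>]] show ?thesis by (rule subset_trans)
      qed
      then show "\<Union>D1 \<subseteq> {a..c}" by blast
      show "(\<Sum>I\<in>D1. Sup I - Inf I) < \<delta>1" using len[of D1] D_split by auto
    qed
    moreover have "(\<Sum>I\<in>D2. norm (f (Sup I) - f (Inf I))) < \<epsilon>/4"
    proof (rule \<delta>2)
      show "D2 division_of \<Union>D2" by (rule division_of_subset[OF D']) (auto simp: D2_def)
      have "K \<subseteq> {c..b}" if "K \<in> D2" for K
      proof -
        have "K \<in> D" using that by (simp add: D2_def)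
        have "{Inf K..Sup K} \<subseteq> {c..b}" using mem[of K] that by (auto simp: D2_def)
        with equalityD1[OF I(2)[OF \<open>K \<in> D\<close>]] show ?thesis by (rule subset_trans)
      qed
      then show "\<Union>D2 \<subseteq> {c..b}" by blast
      show "(\<Sum>I\<in>D2. Sup I - Inf I) < \<delta>2" using len[of D2] D_split by auto
    qed
    moreover have "(\<Sum>I\<in>D3. norm (f (Sup I) - f (Inf I))) < \<epsilon>/2"
    proof (cases "D3 = {}")
      case False
      then obtain J where J: "J \<in> D" "Inf J < c" "c < Sup J" by (auto simp: D3_def)
      have interior: "c \<in> interior K" if "K \<in> D" "Inf K < c" "c < Sup K" for K
        by (subst I(2)[OF that(1)]) (use that in \<open>simp add: interior_atLeastAtMost_real\<close>)
      have "K = J" if "K \<in> D3" for K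
        using that J interior[of K] interior[of J] division_ofD(5)[OF D(1), of K J]
        by (auto simp: D3_def)
      moreover have "J \<in> D3" using J by (simp add: D3_def)
      ultimately have "D3 = {J}" by blast
      \<comment> \<open>\<open>J\<close> alone is shorter than both moduli, so its two halves are
        admissible one-cell divisions on the left and on the right of \<open>c\<close>. Each
        contributes less than \<open>\<epsilon>/4\<close>.\<close>
      have "Sup J - Inf J < min \<delta>1 \<delta>2" using len[of "{J}"] J by simp
      moreover have "{{Inf J..c}} division_of {Inf J..c}" "{{c..Sup J}} division_of {c..Sup J}"
        using division_of_self[of "Inf J" c] division_of_self[of c "Sup J"] J by auto
      ultimately have "norm (f c - f (Inf J)) < \<epsilon>/4" "norm (f (Sup J) - f c) < \<epsilon>/4"
        using \<delta>1[of "{{Inf J..c}}" "{Inf J..c}"] \<delta>2[of "{{c..Sup J}}" "{c..Sup J}"] J mem[of J]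
        by auto
      moreover have "norm (f (Sup J) - f (Inf J)) \<le> norm (f (Sup J) - f c) + norm (f c - f (Inf J))"
        using norm_triangle_ineq[of "f (Sup J) - f c" "f c - f (Inf J)"] by simp
      ultimately show ?thesis using \<open>D3 = {J}\<close> by simp
    qed (use \<open>\<epsilon> > 0\<close> in simp)
    moreover have "finite D1" "finite D2" "finite D3" using fin by (auto simp: D1_def D2_def D3_def)
    ultimately show "(\<Sum>I\<in>D. norm (f (Sup I) - f (Inf I))) < \<epsilon>"
      by (subst D_split(1)) (simp add: sum.union_disjoint D_split)
  qed
qed

subsection \<open>Concatenation of curves\<close>

lemma abs_continuous_curve_cong:
  assumes eq: "\<And>r. r \<in> {0..t} \<Longrightarrow> \<gamma> r = \<gamma>' r"
  shows "abs_continuous_curve A t \<gamma> \<longleftrightarrow> abs_continuous_curve A t \<gamma>'"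
proof -
  have "\<gamma> ` {a..b} = \<gamma>' ` {a..b}"
    "abs_continuous_on {a..b} (snd \<phi> \<circ> \<gamma>) \<longleftrightarrow> abs_continuous_on {a..b} (snd \<phi> \<circ> \<gamma>')"
    if "0 \<le> a" "b \<le> t" for a b and \<phi> :: "('a, 'b) chart"
    using that eq by (auto intro!: image_cong abs_continuous_on_cong)
  moreover have "continuous_on {0..t} \<gamma> \<longleftrightarrow> continuous_on {0..t} \<gamma>'"
    by (intro continuous_on_cong refl eq)
  ultimately show ?thesis unfolding abs_continuous_curve_def by (smt (verit))
qed

text \<open>One direction cuts a curve at time \<open>s\<close>, the other glues two curves there;
  they serve \<open>minimal_action_split\<close> and \<open>minimal_action_concat\<close>.\<close>

lemma abs_continuous_curve_add_iff:
  fixes \<gamma> :: "real \<Rightarrow> 'm::topological_space"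
  assumes st: "0 \<le> s" "0 \<le> t"
  shows "abs_continuous_curve A (s + t) \<gamma> \<longleftrightarrow>
    abs_continuous_curve A s \<gamma> \<and> abs_continuous_curve A t (\<lambda>r. \<gamma> (s + r))"
proof (intro iffI conjI)
  assume AC: "abs_continuous_curve A (s + t) \<gamma>"
  then have cont: "continuous_on {0..s + t} \<gamma>" by (simp add: abs_continuous_curve_def)
  show "abs_continuous_curve A s \<gamma>"
    using AC st continuous_on_subset[OF cont, of "{0..s}"] by (auto simp: abs_continuous_curve_def)
  show "abs_continuous_curve A t (\<lambda>r. \<gamma> (s + r))"
    unfolding abs_continuous_curve_def
  proof (intro conjI ballI allI impI)
    show "continuous_on {0..t} (\<lambda>r. \<gamma> (s + r))"
      by (rule continuous_on_compose2[OF cont]) (use st in \<open>auto intro!: continuous_intros\<close>)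
    fix \<phi> a b
    assume ab: "\<phi> \<in> A" "0 \<le> a" "a \<le> b" "b \<le> t" "(\<lambda>r. \<gamma> (s + r)) ` {a..b} \<subseteq> fst \<phi>"
    have shift: "(+) s ` {a..b} = {s + a..s + b}" by (simp add: add.commute)
    have "\<gamma> ` {s + a..s + b} \<subseteq> fst \<phi>"
      unfolding shift[symmetric] image_image using ab by simp
    then have "abs_continuous_on ((+) s ` {a..b}) (snd \<phi> \<circ> \<gamma>)"
      unfolding shift using AC ab st by (simp add: abs_continuous_curve_def)
    then show "abs_continuous_on {a..b} (snd \<phi> \<circ> (\<lambda>r. \<gamma> (s + r)))"
      using abs_continuous_on_shift[of s "{a..b}" "snd \<phi> \<circ> \<gamma>"] by (simp add: o_def)
  qed
next
  assume AC: "abs_continuous_curve A s \<gamma> \<and> abs_continuous_curve A t (\<lambda>r. \<gamma> (s + r))"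
  have head: "abs_continuous_on {a..b} (snd \<phi> \<circ> \<gamma>)"
    if "\<phi> \<in> A" "0 \<le> a" "a \<le> b" "b \<le> s" "\<gamma> ` {a..b} \<subseteq> fst \<phi>" for \<phi> a b
    using AC that by (simp add: abs_continuous_curve_def)
  have tail: "abs_continuous_on {a..b} (snd \<phi> \<circ> \<gamma>)"
    if "\<phi> \<in> A" "s \<le> a" "a \<le> b" "b \<le> s + t" "\<gamma> ` {a..b} \<subseteq> fst \<phi>" for \<phi> a b
  proof -
    have shift: "(+) (-s) ` {a..b} = {a - s..b - s}" by (simp add: add.commute)
    have "(\<lambda>r. \<gamma> (s + r)) ` {a - s..b - s} \<subseteq> fst \<phi>"
      unfolding shift[symmetric] image_image using that by simp
    then have "abs_continuous_on ((+) (-s) ` {a..b}) (snd \<phi> \<circ> (\<lambda>r. \<gamma> (s + r)))"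
      unfolding shift using AC that by (simp add: abs_continuous_curve_def)
    then show ?thesis
      using abs_continuous_on_shift[of "-s" "{a..b}" "snd \<phi> \<circ> (\<lambda>r. \<gamma> (s + r))"] by (simp add: o_def)
  qed
  show "abs_continuous_curve A (s + t) \<gamma>"
    unfolding abs_continuous_curve_def
  proof (intro conjI ballI allI impI)
    have "continuous_on {0..t} (\<lambda>r. \<gamma> (s + r))" using AC by (simp add: abs_continuous_curve_def)
    then have "continuous_on {s..s + t} (\<lambda>r. \<gamma> (s + (r - s)))"
      by (rule continuous_on_compose2) (auto intro!: continuous_intros)
    then have "continuous_on ({0..s} \<union> {s..s + t}) \<gamma>"
      using AC by (intro continuous_on_closed_Un) (auto simp: abs_continuous_curve_def)
    then show "continuous_on {0..s + t} \<gamma>" using st by (simp add: ivl_disj_un_two_touch)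
    fix \<phi> a b
    assume ab: "\<phi> \<in> A" "0 \<le> a" "a \<le> b" "b \<le> s + t" "\<gamma> ` {a..b} \<subseteq> fst \<phi>"
    \<comment> \<open>Within one chart, an interval that straddles \<open>s\<close> is cut there,
      and the coordinate curve is recovered by joining its two halves.\<close>
    consider "b \<le> s" | "s \<le> a" | "a < s" "s < b" by linarith
    then show "abs_continuous_on {a..b} (snd \<phi> \<circ> \<gamma>)"
    proof cases
      case 3
      show ?thesis
      proof (rule abs_continuous_on_join)
        show "abs_continuous_on {a..s} (snd \<phi> \<circ> \<gamma>)"
          by (rule head) (use ab 3 in auto)
        show "abs_continuous_on {s..b} (snd \<phi> \<circ> \<gamma>)"
          by (rule tail) (use ab 3 in auto)
      qed
    qed (use ab head tail in auto)
  qed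
qed

section \<open>Velocity and additivity of the action\<close>

text \<open>\<open>velocity\<close> uses the two-sided derivative, so agreement at one point or on
  one side of it would not suffice.\<close>

lemma velocity_cong:
  fixes \<gamma> :: "real \<Rightarrow> 'm" and A :: "('m, 'e::euclidean_space) chart set"
  assumes "\<forall>\<^sub>F r in nhds s. \<gamma> r = \<gamma>' r"
  shows "velocity A \<gamma> s = velocity A \<gamma>' s"
proof -
  have "vector_derivative (f \<circ> \<gamma>) (at s) = vector_derivative (f \<circ> \<gamma>') (at s)" for f :: "'m \<Rightarrow> 'e"
    by (rule vector_derivative_cong_eq) (use assms in \<open>auto elim: eventually_mono\<close>)
  moreover have "\<gamma> s = \<gamma>' s" using assms by (rule eventually_nhds_x_imp_x)
  ultimately show ?thesis by (simp add: velocity_def fun_eq_iff)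
qed

text \<open>\<open>vector_derivative\<close> is a choice among the vectors satisfying the derivative
  predicate. An equivalence makes the choices agree even at times where no derivative
  exists.\<close>

lemma has_vector_derivative_shift_iff:
  fixes f :: "real \<Rightarrow> 'a::real_normed_vector"
  shows "((\<lambda>r. f (c + r)) has_vector_derivative D) (at s) \<longleftrightarrow> (f has_vector_derivative D) (at (c + s))"
proof
  assume "((\<lambda>r. f (c + r)) has_vector_derivative D) (at s)"
  then have "((\<lambda>r. f (c + r)) \<circ> (\<lambda>r. r - c) has_vector_derivative 1 *\<^sub>R D) (at (c + s))"
    by (intro vector_diff_chain_at) (auto intro!: derivative_eq_intros)
  then show "(f has_vector_derivative D) (at (c + s))" by (simp add: o_def)
next
  assume "(f has_vector_derivative D) (at (c + s))"
  then have "(f \<circ> (\<lambda>r. c + r) has_vector_derivative 1 *\<^sub>R D) (at s)"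
    by (intro vector_diff_chain_at) (auto intro!: derivative_eq_intros)
  then show "((\<lambda>r. f (c + r)) has_vector_derivative D) (at s)" by (simp add: o_def)
qed

lemma velocity_shift:
  fixes \<gamma> :: "real \<Rightarrow> 'm" and A :: "('m, 'e::euclidean_space) chart set"
  shows "velocity A (\<lambda>r. \<gamma> (c + r)) s = velocity A \<gamma> (c + s)"
proof -
  have "vector_derivative (f \<circ> (\<lambda>r. \<gamma> (c + r))) (at s) = vector_derivative (f \<circ> \<gamma>) (at (c + s))"
    for f :: "'m \<Rightarrow> 'e"
    using has_vector_derivative_shift_iff[of "f \<circ> \<gamma>" c _ s]
    by (simp add: vector_derivative_def o_def)
  then show ?thesis by (simp add: velocity_def fun_eq_iff)
qed

text \<open>At the end points the velocities also depend on the curves outside \<open>{0..t}\<close>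
  and may differ. These are only two points, a negligible set for the integral.\<close>

lemma action_cong:
  assumes eq: "\<And>r. r \<in> {0..t} \<Longrightarrow> \<gamma> r = \<gamma>' r"
  shows "action A L t \<gamma> = action A L t \<gamma>'"
proof -
  have "L (\<gamma> r) (velocity A \<gamma> r) = L (\<gamma>' r) (velocity A \<gamma>' r)" if "r \<in> {0..t} - {0, t}" for r
  proof -
    have "\<forall>\<^sub>F q in nhds r. q \<in> {0<..<t}"
      using that by (intro eventually_nhds_in_open) auto
    then have "velocity A \<gamma> r = velocity A \<gamma>' r"
      by (intro velocity_cong) (auto elim!: eventually_mono intro!: eq)
    with eq that show ?thesis by auto
  qed
  note spike = this
  have neg: "negligible {0, t}" by simp
  have "(\<lambda>s. L (\<gamma> s) (velocity A \<gamma> s)) absolutely_integrable_on {0..t} \<longleftrightarrow>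
      (\<lambda>s. L (\<gamma>' s) (velocity A \<gamma>' s)) absolutely_integrable_on {0..t}"
    using spike by (intro absolutely_integrable_spike_eq[OF neg]) auto
  moreover have "integral {0..t} (\<lambda>s. L (\<gamma> s) (velocity A \<gamma> s)) =
      integral {0..t} (\<lambda>s. L (\<gamma>' s) (velocity A \<gamma>' s))"
    using spike by (intro integral_spike[OF neg]) auto
  ultimately show ?thesis by (simp add: action_def)
qed

text \<open>The integrand is absolutely integrable on the whole interval iff it is so on both parts,
  so the value \<open>\<infinity>\<close> occurs on both sides simultaneously. Otherwise this is
  additivity of the integral after a shift.\<close>

lemma action_add:
  assumes st: "0 \<le> s" "0 \<le> t"
  shows "action A L (s + t) \<gamma> = action A L s \<gamma> + action A L t (\<lambda>r. \<gamma> (s + r))"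
proof -
  define f where "f r = L (\<gamma> r) (velocity A \<gamma> r)" for r
  have shift: "(\<lambda>r. f (s + r)) absolutely_integrable_on {0..t} \<longleftrightarrow> f absolutely_integrable_on {s..s + t}"
    using integrable_on_shift_Icc_real[of f s 0 t]
      integrable_on_shift_Icc_real[of "\<lambda>r. norm (f r)" s 0 t]
    by (simp add: absolutely_integrable_on_def o_def add.commute)
  have union: "f absolutely_integrable_on {0..s + t} \<longleftrightarrow>
      f absolutely_integrable_on {0..s} \<and> f absolutely_integrable_on {s..s + t}"
  proof (intro iffI conjI)
    assume f: "f absolutely_integrable_on {0..s + t}"
    show "f absolutely_integrable_on {0..s}" "f absolutely_integrable_on {s..s + t}"
      by (rule absolutely_integrable_on_subinterval[OF f]; use st in force)+
  qed (use st in \<open>auto intro: absolutely_integrable_on_combine\<close>)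
  have "integral {0..s + t} f = integral {0..s} f + integral {0..t} (\<lambda>r. f (s + r))"
    if "f absolutely_integrable_on {0..s + t}"
  proof -
    have "integral {0..t} (\<lambda>r. f (s + r)) = integral {s..s + t} f"
      using integral_shift_Icc_real[of 0 t f s] by (simp add: o_def add.commute)
    moreover have "f integrable_on {0..s + t}"
      using that by (simp add: absolutely_integrable_on_def)
    ultimately show ?thesis
      using Henstock_Kurzweil_Integration.integral_combine[where f = f and a = 0 and c = s and b = "s + t"] st by simp
  qed
  then show ?thesis
    unfolding action_def velocity_shift f_def[symmetric] shift union by auto
qed

lemma action_neq_minfty: "action A L t \<gamma> \<noteq> -\<infinity>"
  by (simp add: action_def)

section \<open>Minimal action under concatenation\<close>

text \<open>A strict upper bound on an infimum is witnessed by an actual curve, and strict upper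
  bounds by reals can be added without meeting infinite values. Later estimates are stated in this
  form.\<close>

lemma minimal_action_less_iff:
  "minimal_action A L t x y < c \<longleftrightarrow>
    (\<exists>\<gamma>. abs_continuous_curve A t \<gamma> \<and> \<gamma> 0 = x \<and> \<gamma> t = y \<and> action A L t \<gamma> < c)"
  by (auto simp: minimal_action_def INF_less_iff)

lemma minimal_action_concat:
  assumes st: "0 < s" "0 < t"
    and "minimal_action A L s x y < ereal a" "minimal_action A L t y z < ereal b"
  shows "minimal_action A L (s + t) x z < ereal (a + b)"
proof -
  obtain \<gamma>1 where 1: "abs_continuous_curve A s \<gamma>1" "\<gamma>1 0 = x" "\<gamma>1 s = y" "action A L s \<gamma>1 < ereal a"
    using assms(3) by (auto simp: minimal_action_less_iff)
  obtain \<gamma>2 where 2: "abs_continuous_curve A t \<gamma>2" "\<gamma>2 0 = y" "\<gamma>2 t = z" "action A L t \<gamma>2 < ereal b"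
    using assms(4) by (auto simp: minimal_action_less_iff)
  define \<gamma> where "\<gamma> r = (if r \<le> s then \<gamma>1 r else \<gamma>2 (r - s))" for r
  have eq1: "\<gamma> r = \<gamma>1 r" if "r \<in> {0..s}" for r using that by (simp add: \<gamma>_def)
  \<comment> \<open>At \<open>r = 0\<close> the first branch of \<open>\<gamma>\<close> applies; it
    agrees with \<open>\<gamma>2\<close> because both curves pass through \<open>y\<close>.\<close>
  have eq2: "\<gamma> (s + r) = \<gamma>2 r" if "r \<in> {0..t}" for r
    using that 1(3) 2(2) by (cases "r = 0") (auto simp: \<gamma>_def)
  have "abs_continuous_curve A (s + t) \<gamma>"
    using st 1 2 abs_continuous_curve_cong[OF eq1, where A = A]
      abs_continuous_curve_cong[OF eq2, where A = A]
    by (simp add: abs_continuous_curve_add_iff)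
  moreover have "\<gamma> 0 = x" "\<gamma> (s + t) = z" using st 1 2 eq1[of 0] eq2[of t] by auto
  moreover have "action A L (s + t) \<gamma> = action A L s \<gamma>1 + action A L t \<gamma>2"
  proof -
    have "action A L s \<gamma> = action A L s \<gamma>1" by (rule action_cong) (rule eq1)
    moreover have "action A L t (\<lambda>r. \<gamma> (s + r)) = action A L t \<gamma>2"
      by (rule action_cong) (rule eq2)
    ultimately show ?thesis using st by (simp add: action_add)
  qed
  moreover have "\<dots> < ereal (a + b)"
    using ereal_add_strict_mono2[OF 1(4) 2(4)] by simp
  ultimately show ?thesis by (auto simp: minimal_action_less_iff)
qed

lemma minimal_action_split:
  assumes st: "0 < s" "0 < t" and less: "minimal_action A L (s + t) x z < ereal c"
  shows "\<exists>y a b. minimal_action A L s x y < ereal a \<and> minimal_action A L t y z < ereal b \<and> a + b = c"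
proof -
  obtain \<gamma> where \<gamma>: "abs_continuous_curve A (s + t) \<gamma>" "\<gamma> 0 = x" "\<gamma> (s + t) = z"
      "action A L (s + t) \<gamma> < ereal c"
    using less by (auto simp: minimal_action_less_iff)
  let ?\<gamma>' = "\<lambda>r. \<gamma> (s + r)"
  have less: "action A L s \<gamma> + action A L t ?\<gamma>' < ereal c"
    using \<gamma>(4) st by (simp add: action_add)
  \<comment> \<open>Neither action is \<open>-\<infinity>\<close>, so a sum below a real number
    forces both to be finite.\<close>
  then obtain a b where ab: "action A L s \<gamma> = ereal a" "action A L t ?\<gamma>' = ereal b" "a + b < c"
  proof (cases "action A L s \<gamma>" "action A L t ?\<gamma>'" rule: ereal2_cases)
    case (real_real a b)
    with that show thesis using less by simp
  qed (use less action_neq_minfty[of A L s \<gamma>] action_neq_minfty[of A L t ?\<gamma>'] in simp_all)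
  \<comment> \<open>Half of the slack goes to each piece, so that the two bounds add up to
    \<open>c\<close> exactly.\<close>
  define d where "d = (c - a - b) / 2"
  have "abs_continuous_curve A s \<gamma>" "abs_continuous_curve A t ?\<gamma>'"
    using \<gamma>(1) st by (simp_all add: abs_continuous_curve_add_iff)
  moreover have "d > 0" "(a + d) + (b + d) = c" using ab(3) by (simp_all add: d_def field_simps)
  ultimately have "minimal_action A L s x (\<gamma> s) < ereal (a + d)"
    "minimal_action A L t (\<gamma> s) z < ereal (b + d)"
    unfolding minimal_action_less_iff using \<gamma>(2,3) ab
    by (intro exI[of _ \<gamma>] exI[of _ ?\<gamma>']; simp)+
  with \<open>(a + d) + (b + d) = c\<close> show ?thesis by blast
qed

subsection \<open>Straight lines in charts\<close>

lemma Ck_on_imp_continuous_on: "Ck_on k f S \<Longrightarrow> continuous_on S f"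
  by (cases k) (auto intro!: differentiable_imp_continuous_on differentiable_at_imp_differentiable_on)

lemma chart_inv_left:
  assumes "smooth_atlas A" "\<phi> \<in> A" "x \<in> fst \<phi>"
  shows "chart_inv \<phi> (snd \<phi> x) = x"
  using assms by (auto simp: smooth_atlas_def is_chart_def homeomorphism_def)

lemma chart_right_inv:
  assumes "p \<in> snd \<phi> ` fst \<phi>"
  shows "snd \<phi> (chart_inv \<phi> p) = p" "chart_inv \<phi> p \<in> fst \<phi>"
  using assms by (auto simp: f_inv_into_f inv_into_into)

lemma transition_has_derivative:
  assumes A: "smooth_atlas A" "\<phi> \<in> A" "\<psi> \<in> A" and p: "p \<in> snd \<phi> ` fst \<phi>" "chart_inv \<phi> p \<in> fst \<psi>"
  shows "(snd \<psi> \<circ> chart_inv \<phi> has_derivative frechet_derivative (snd \<psi> \<circ> chart_inv \<phi>) (at p)) (at p)"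
    and "p \<in> snd \<phi> ` (fst \<phi> \<inter> fst \<psi>)"
proof -
  show p': "p \<in> snd \<phi> ` (fst \<phi> \<inter> fst \<psi>)"
    using chart_right_inv[OF p(1)] p(2) by (metis IntI imageI)
  have "Ck_on (Suc 0) (snd \<psi> \<circ> chart_inv \<phi>) (snd \<phi> ` (fst \<phi> \<inter> fst \<psi>))"
    using A unfolding smooth_atlas_def smooth_on_def by blast
  with p' show "(snd \<psi> \<circ> chart_inv \<phi> has_derivative frechet_derivative (snd \<psi> \<circ> chart_inv \<phi>) (at p)) (at p)"
    by (auto simp: frechet_derivative_works[symmetric])
qed

lemma transition_derivative_continuous_on:
  assumes A: "smooth_atlas A" "\<phi> \<in> A" "\<psi> \<in> A"
  shows "continuous_on (snd \<phi> ` (fst \<phi> \<inter> fst \<psi>))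
    (\<lambda>p. frechet_derivative (snd \<psi> \<circ> chart_inv \<phi>) (at p) w)"
proof -
  have "Ck_on (Suc 0) (snd \<psi> \<circ> chart_inv \<phi>) (snd \<phi> ` (fst \<phi> \<inter> fst \<psi>))"
    using A unfolding smooth_atlas_def smooth_on_def by blast
  then show ?thesis by simp
qed

text \<open>The line is straight in \<open>\<phi>\<close> only. In another chart
  \<open>\<psi>\<close> the chain rule gives the transition derivative applied to \<open>w\<close>,
  the same vector that \<open>of_coords\<close> assigns.\<close>

lemma chart_line_has_vector_derivative:
  assumes A: "smooth_atlas A" "\<phi> \<in> A" "\<psi> \<in> A"
    and p: "p + r *\<^sub>R w \<in> snd \<phi> ` fst \<phi>" "chart_inv \<phi> (p + r *\<^sub>R w) \<in> fst \<psi>"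
  shows "(snd \<psi> \<circ> (\<lambda>r. chart_inv \<phi> (p + r *\<^sub>R w)) has_vector_derivative
    frechet_derivative (snd \<psi> \<circ> chart_inv \<phi>) (at (p + r *\<^sub>R w)) w) (at r)"
proof -
  let ?T = "snd \<psi> \<circ> chart_inv \<phi>" and ?q = "p + r *\<^sub>R w"
  have T: "(?T has_derivative frechet_derivative ?T (at ?q)) (at ?q)"
    by (rule transition_has_derivative(1)[OF A p])
  have "((\<lambda>r. p + r *\<^sub>R w) has_derivative (\<lambda>h. h *\<^sub>R w)) (at r)"
    by (auto intro!: derivative_eq_intros)
  then have "(?T \<circ> (\<lambda>r. p + r *\<^sub>R w) has_derivative frechet_derivative ?T (at ?q) \<circ> (\<lambda>h. h *\<^sub>R w)) (at r)"
    by (rule diff_chain_at) (rule T)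
  moreover have "frechet_derivative ?T (at ?q) (h *\<^sub>R w) = h *\<^sub>R frechet_derivative ?T (at ?q) w" for h
    using linear_scale[OF has_derivative_linear[OF T]] by simp
  ultimately show ?thesis by (simp add: has_vector_derivative_def o_def)
qed

text \<open>Absolute continuity is required in every chart. There the line has continuous, hence
  bounded, velocity on a compact interval, and so it is Lipschitz.\<close>

lemma chart_line_abs_continuous:
  assumes A: "smooth_atlas A" "\<phi> \<in> A"
    and line: "\<And>r. r \<in> {0..s} \<Longrightarrow> p + r *\<^sub>R w \<in> snd \<phi> ` fst \<phi>"
  shows "abs_continuous_curve A s (\<lambda>r. chart_inv \<phi> (p + r *\<^sub>R w))"
  unfolding abs_continuous_curve_def
proof (intro conjI ballI allI impI)
  have "continuous_on (snd \<phi> ` fst \<phi>) (chart_inv \<phi>)"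
    using A by (auto simp: smooth_atlas_def is_chart_def homeomorphism_def)
  then show "continuous_on {0..s} (\<lambda>r. chart_inv \<phi> (p + r *\<^sub>R w))"
    by (rule continuous_on_compose2) (use line in \<open>auto intro!: continuous_intros\<close>)
  fix \<psi> a b
  assume \<psi>: "\<psi> \<in> A" and ab: "0 \<le> a" "a \<le> b" "b \<le> s"
    and im: "(\<lambda>r. chart_inv \<phi> (p + r *\<^sub>R w)) ` {a..b} \<subseteq> fst \<psi>"
  let ?f = "snd \<psi> \<circ> (\<lambda>r. chart_inv \<phi> (p + r *\<^sub>R w))"
  let ?D = "\<lambda>r. frechet_derivative (snd \<psi> \<circ> chart_inv \<phi>) (at (p + r *\<^sub>R w)) w"
  have dom: "p + r *\<^sub>R w \<in> snd \<phi> ` fst \<phi>" "chart_inv \<phi> (p + r *\<^sub>R w) \<in> fst \<psi>" if "r \<in> {a..b}" for r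
    using line im ab that by auto
  have "continuous_on {a..b} ?D"
    by (rule continuous_on_compose2[OF transition_derivative_continuous_on[OF A \<psi>]])
      (use transition_has_derivative(2)[OF A \<psi> dom] in \<open>auto intro!: continuous_intros\<close>)
  then have "bounded (?D ` {a..b})"
    by (intro compact_imp_bounded compact_continuous_image) auto
  then obtain B where B: "\<And>r. r \<in> {a..b} \<Longrightarrow> norm (?D r) \<le> B"
    unfolding bounded_iff by blast
  show "abs_continuous_on {a..b} ?f"
  proof (rule lipschitz_imp_abs_continuous_on)
    fix x y assume xy: "x \<in> {a..b}" "y \<in> {a..b}"
    have "norm (?f x - ?f y) \<le> B * norm (x - y)"
    proof (rule differentiable_bound[OF convex_real_interval(5) _ _ xy])
      fix r assume r: "r \<in> {a..b}"
      show "(?f has_derivative (\<lambda>h. h *\<^sub>R ?D r)) (at r within {a..b})"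
        using chart_line_has_vector_derivative[OF A \<psi> dom[OF r]]
        unfolding has_vector_derivative_def by (rule has_derivative_at_withinI)
      show "onorm (\<lambda>h::real. h *\<^sub>R ?D r) \<le> B"
        using mult_right_mono[OF B[OF r] abs_ge_zero] by (intro onorm_le) (simp add: mult.commute)
    qed
    then show "norm (?f x - ?f y) \<le> B * \<bar>x - y\<bar>" by simp
  qed
qed

lemma velocity_chart_line:
  assumes A: "smooth_atlas A" "\<phi> \<in> A" and p: "p + r *\<^sub>R w \<in> snd \<phi> ` fst \<phi>"
  shows "velocity A (\<lambda>r. chart_inv \<phi> (p + r *\<^sub>R w)) r = of_coords A \<phi> (chart_inv \<phi> (p + r *\<^sub>R w)) w"
  using chart_right_inv(1)[OF p] chart_line_has_vector_derivative[OF A _ p]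
  by (auto simp: velocity_def of_coords_def fun_eq_iff vector_derivative_at)

text \<open>The test curve is the coordinate segment traversed in time \<open>s\<close>. Its
  coordinate speed is at most 1 by the distance hypothesis, it stays in the convex set
  \<open>K\<close>, and the integrand along it is at most \<open>C\<close>.\<close>

lemma minimal_action_chart_le:
  assumes A: "smooth_atlas A" "\<phi> \<in> A"
    and K: "convex K" "K \<subseteq> snd \<phi> ` fst \<phi>"
    and cont: "continuous_on (K \<times> UNIV) (\<lambda>(p, w). L (chart_inv \<phi> p) (of_coords A \<phi> (chart_inv \<phi> p) w))"
    and bound: "\<And>p w. p \<in> K \<Longrightarrow> norm w \<le> 1 \<Longrightarrow> L (chart_inv \<phi> p) (of_coords A \<phi> (chart_inv \<phi> p) w) \<le> C"
    and xy: "x \<in> fst \<phi>" "y \<in> fst \<phi>" "snd \<phi> x \<in> K" "snd \<phi> y \<in> K"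
    and s: "0 < s" "dist (snd \<phi> x) (snd \<phi> y) \<le> s"
  shows "minimal_action A L s x y \<le> ereal (C * s)"
proof -
  let ?p = "snd \<phi> x" and ?q = "snd \<phi> y"
  define w where "w = (?q - ?p) /\<^sub>R s"
  have "norm w = dist ?p ?q / s"
    using s by (simp add: w_def dist_norm norm_minus_commute divide_inverse mult.commute)
  then have w: "norm w \<le> 1" using s by simp
  let ?\<sigma> = "\<lambda>r. chart_inv \<phi> (?p + r *\<^sub>R w)"
  let ?F = "\<lambda>p. L (chart_inv \<phi> p) (of_coords A \<phi> (chart_inv \<phi> p) w)"
  have line: "?p + r *\<^sub>R w \<in> K" if "r \<in> {0..s}" for r
  proof -
    have "(1 - r / s) *\<^sub>R ?p + (r / s) *\<^sub>R ?q \<in> K"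
      using that s K xy by (intro convexD) auto
    also have "(1 - r / s) *\<^sub>R ?p + (r / s) *\<^sub>R ?q = ?p + r *\<^sub>R w"
      by (simp add: w_def scaleR_diff_left scaleR_diff_right divide_inverse)
    finally show ?thesis .
  qed
  have "?\<sigma> 0 = x" "?\<sigma> s = y" using s xy A by (simp_all add: w_def chart_inv_left)
  moreover have "abs_continuous_curve A s ?\<sigma>"
    using line K by (intro chart_line_abs_continuous A) auto
  ultimately have "minimal_action A L s x y \<le> action A L s ?\<sigma>"
    unfolding minimal_action_def by (intro INF_lower) auto
  also have "action A L s ?\<sigma> \<le> ereal (C * s)"
  proof -
    let ?f = "\<lambda>r. L (?\<sigma> r) (velocity A ?\<sigma> r)"
    have f: "?f r = ?F (?p + r *\<^sub>R w)" if "r \<in> {0..s}" for r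
      using line[OF that] K by (subst velocity_chart_line[OF A]) auto
    have "continuous_on {0..s} (\<lambda>r. (?p + r *\<^sub>R w, w))" by (intro continuous_intros)
    moreover have "(\<lambda>r. (?p + r *\<^sub>R w, w)) ` {0..s} \<subseteq> K \<times> UNIV" using line by blast
    ultimately have "continuous_on {0..s} (\<lambda>r. ?F (?p + r *\<^sub>R w))"
      using continuous_on_compose2[OF cont, of "{0..s}" "\<lambda>r. (?p + r *\<^sub>R w, w)"] by simp
    then have cont_f: "continuous_on {0..s} ?f" by (subst continuous_on_cong[OF refl f])
    have "integral {0..s} ?f \<le> integral {0..s} (\<lambda>_. C)"
      using cont_f by (intro integral_le) (auto simp: f intro!: integrable_continuous_real bound w line)
    also have "\<dots> = C * s" using s by simp
    finally show ?thesis
      using absolutely_integrable_continuous_real[OF cont_f] by (simp add: action_def)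
  qed
  finally show ?thesis .
qed

text \<open>On a compact coordinate ball and for coordinate velocities of norm at most 1,
  \<open>L\<close> is bounded by continuity, so segments traversed in a short time cost little. Both
  directions are recorded because the action need not be symmetric.\<close>

lemma minimal_action_eventually_small:
  fixes A :: "('m::{t2_space, second_countable_topology}, 'e::euclidean_space) chart set"
  assumes A: "smooth_atlas A" and L: "tonelli_lagrangian A g L" and e: "0 < e"
  shows "\<forall>\<^sub>F y in nhds x.
    (\<exists>s>0. minimal_action A L s x y < ereal e) \<and> (\<exists>s>0. minimal_action A L s y x < ereal e)"
proof -
  obtain \<phi> where \<phi>: "\<phi> \<in> A" "x \<in> fst \<phi>"
    using A unfolding smooth_atlas_def by blast
  let ?F = "\<lambda>(p, w). L (chart_inv \<phi> p) (of_coords A \<phi> (chart_inv \<phi> p) w)"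
  have chart: "open (fst \<phi>)" "open (snd \<phi> ` fst \<phi>)" "continuous_on (fst \<phi>) (snd \<phi>)"
    using A \<phi> by (auto simp: smooth_atlas_def is_chart_def homeomorphism_def)
  then obtain R where R: "R > 0" "cball (snd \<phi> x) R \<subseteq> snd \<phi> ` fst \<phi>"
    using \<phi> by (meson imageI open_contains_cball)
  have "Ck_on 2 ?F ((snd \<phi> ` fst \<phi>) \<times> UNIV)"
    using L \<phi>(1) unfolding tonelli_lagrangian_def by (elim conjE) (erule bspec)
  then have "continuous_on ((snd \<phi> ` fst \<phi>) \<times> UNIV) ?F" by (rule Ck_on_imp_continuous_on)
  then have cont: "continuous_on (cball (snd \<phi> x) R \<times> UNIV) ?F"
    by (rule continuous_on_subset) (use R in auto)
  then have "continuous_on (cball (snd \<phi> x) R \<times> cball 0 1) ?F"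
    by (rule continuous_on_subset) auto
  then have "bounded (?F ` (cball (snd \<phi> x) R \<times> cball 0 1))"
    by (intro compact_imp_bounded compact_continuous_image compact_Times compact_cball)
  then obtain C where "C > 0" and C: "\<And>z. z \<in> cball (snd \<phi> x) R \<times> cball 0 1 \<Longrightarrow> norm (?F z) \<le> C"
    unfolding bounded_pos by blast
  have bound: "L (chart_inv \<phi> p) (of_coords A \<phi> (chart_inv \<phi> p) w) \<le> C"
    if "p \<in> cball (snd \<phi> x) R" "norm w \<le> 1" for p w
    using C[of "(p, w)"] that by auto
  \<comment> \<open>\<open>s \<le> R\<close> keeps points at coordinate distance less than
    \<open>s\<close> inside the ball, and \<open>s \<le> e / (2 * C)\<close> makes the cost
    \<open>C * s\<close> at most \<open>e / 2\<close>.\<close>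
  define s where "s = min R (e / (2 * C))"
  have s: "s > 0" "s \<le> R" using \<open>C > 0\<close> R e by (auto simp: s_def)
  have "C * s \<le> C * (e / (2 * C))" using \<open>C > 0\<close> by (intro mult_left_mono) (auto simp: s_def)
  also have "\<dots> < e" using \<open>C > 0\<close> e by simp
  finally have Cs: "C * s < e" .
  have "isCont (snd \<phi>) x" using chart \<phi> continuous_on_eq_continuous_at by blast
  then have "filterlim (snd \<phi>) (nhds (snd \<phi> x)) (nhds x)"
    by (simp add: isCont_def tendsto_at_iff_tendsto_nhds)
  then have "\<forall>\<^sub>F y in nhds x. dist (snd \<phi> y) (snd \<phi> x) < s"
    using s(1) by (rule tendstoD)
  moreover have "\<forall>\<^sub>F y in nhds x. y \<in> fst \<phi>" using chart(1) \<phi>(2) by (rule eventually_nhds_in_open)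
  ultimately show ?thesis
  proof eventually_elim
    case (elim y)
    note le = minimal_action_chart_le[OF A \<phi>(1) convex_cball R(2) cont bound]
    have "minimal_action A L s x y \<le> ereal (C * s)"
      by (rule le) (use elim \<phi> s in \<open>auto simp: dist_commute\<close>)
    moreover have "minimal_action A L s y x \<le> ereal (C * s)"
      by (rule le) (use elim \<phi> s in \<open>auto simp: dist_commute\<close>)
    ultimately have "minimal_action A L s x y < ereal e" "minimal_action A L s y x < ereal e"
      using Cs by (auto intro: le_less_trans)
    with s(1) show ?case by blast
  qed
qed

subsection \<open>Barriers\<close>

text \<open>What is kept of the minimal action: \<open>concat\<close> and \<open>split\<close> are
  the two inequalities of the semigroup law
  \<open>m (s + t) x z = (INF y. m s x y + m t y z)\<close>, written with strict real bounds so that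
  infinite values are never added. A real-valued \<open>H\<close> encodes that the barrier is
  finite.\<close>

locale action_barrier =
  fixes m :: "real \<Rightarrow> 'm::{t2_space, second_countable_topology} \<Rightarrow> 'm \<Rightarrow> ereal"
    and H :: "'m \<Rightarrow> 'm \<Rightarrow> real"
  assumes compact_space: "compact (UNIV :: 'm set)"
    and barrier: "ereal (H x y) = Liminf at_top (\<lambda>t. m t x y)"
    and concat: "\<lbrakk>0 < s; 0 < t; m s x y < ereal a; m t y z < ereal b\<rbrakk> \<Longrightarrow> m (s + t) x z < ereal (a + b)"
    and split: "\<lbrakk>0 < s; 0 < t; m (s + t) x z < ereal c\<rbrakk> \<Longrightarrow>
      \<exists>y a b. m s x y < ereal a \<and> m t y z < ereal b \<and> a + b = c"
    and near: "0 < e \<Longrightarrow>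
      \<forall>\<^sub>F y in nhds x. (\<exists>s>0. m s x y < ereal e) \<and> (\<exists>s>0. m s y x < ereal e)"
begin

section \<open>Triangle inequality and continuity of the barrier\<close>

text \<open>This lemma and the next are the two halves of the lower limit, in a form that meets the
  strict bounds of \<open>concat\<close> and \<open>split\<close>.\<close>

lemma eventually_above_barrier:
  assumes "c < H x y"
  obtains T where "\<And>t. T \<le> t \<Longrightarrow> ereal c < m t x y"
proof -
  have "ereal c < Liminf at_top (\<lambda>t. m t x y)" using assms barrier[of x y] by (metis less_ereal.simps(1))
  from less_LiminfD[OF this] that show ?thesis by (auto simp: eventually_at_top_linorder)
qed

lemma frequently_below_barrier:
  assumes "H x y < c"
  obtains t where "T \<le> t" "0 < t" "m t x y < ereal c"
proof (rule ccontr)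
  assume *: "\<not> thesis"
  have "ereal c \<le> m t x y" if "max T 1 \<le> t" for t
    using that * \<open>\<And>t. T \<le> t \<Longrightarrow> 0 < t \<Longrightarrow> m t x y < ereal c \<Longrightarrow> thesis\<close> by force
  then have "\<forall>\<^sub>F t in at_top. ereal c \<le> m t x y"
    unfolding eventually_at_top_linorder by blast
  then have "ereal c \<le> Liminf at_top (\<lambda>t. m t x y)" by (rule Liminf_bounded)
  with barrier[of x y] assms show False by (metis ereal_less_eq(3) not_le)
qed

lemma barrier_triangle: "H x z \<le> H x y + H y z"
proof (rule ccontr)
  assume neg: "\<not> ?thesis"
  \<comment> \<open>A third of the gap is the slack of each near-optimal piece; the remaining third
    keeps their total strictly below \<open>H x z\<close>.\<close>
  define d where "d = (H x z - (H x y + H y z)) / 3"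
  have d: "d > 0" "H x z = H x y + H y z + 3 * d" using neg by (auto simp: d_def field_simps)
  obtain T where T: "\<And>t. T \<le> t \<Longrightarrow> ereal (H x y + d + (H y z + d)) < m t x z"
    using eventually_above_barrier[of "H x y + d + (H y z + d)" x z] d by auto
  obtain s where s: "T \<le> s" "0 < s" "m s x y < ereal (H x y + d)"
    using frequently_below_barrier[of x y "H x y + d"] d by auto
  obtain t where t: "0 < t" "m t y z < ereal (H y z + d)"
    using frequently_below_barrier[of y z "H y z + d"] d by auto
  have "m (s + t) x z < ereal (H x y + d + (H y z + d))"
    using s t by (intro concat) auto
  with T[of "s + t"] s t show False by auto
qed

text \<open>Appending a piece of fixed duration to ever longer near-optimal pieces leaves durations
  tending to infinity, so the barrier grows by at most the bound on its cost.\<close>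

lemma barrier_step_right:
  assumes s: "0 < s" "m s y z < ereal e"
  shows "H x z \<le> H x y + e"
proof (rule ccontr)
  assume neg: "\<not> ?thesis"
  define d where "d = (H x z - (H x y + e)) / 2"
  have d: "d > 0" "H x z = H x y + e + 2 * d" using neg by (auto simp: d_def field_simps)
  obtain T where T: "\<And>t. T \<le> t \<Longrightarrow> ereal (H x y + d + e) < m t x z"
    using eventually_above_barrier[of "H x y + d + e" x z] d by auto
  obtain t where t: "T \<le> t" "0 < t" "m t x y < ereal (H x y + d)"
    using frequently_below_barrier[of x y "H x y + d"] d by auto
  have "m (t + s) x z < ereal (H x y + d + e)" using s t by (intro concat) auto
  with T[of "t + s"] s t show False by auto
qed

lemma barrier_step_left:
  assumes s: "0 < s" "m s x y < ereal e"
  shows "H x z \<le> e + H y z"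
proof (rule ccontr)
  assume neg: "\<not> ?thesis"
  define d where "d = (H x z - (e + H y z)) / 2"
  have d: "d > 0" "H x z = e + H y z + 2 * d" using neg by (auto simp: d_def field_simps)
  obtain T where T: "\<And>t. T \<le> t \<Longrightarrow> ereal (e + (H y z + d)) < m t x z"
    using eventually_above_barrier[of "e + (H y z + d)" x z] d by auto
  obtain t where t: "T \<le> t" "0 < t" "m t y z < ereal (H y z + d)"
    using frequently_below_barrier[of y z "H y z + d"] d by auto
  have "m (s + t) x z < ereal (e + (H y z + d))" using s t by (intro concat) auto
  with T[of "s + t"] s t show False by auto
qed

text \<open>Cheap steps from \<open>a\<close> to \<open>f n\<close> and back give the two one-sided
  estimates. The non-strict bound \<open>e/2\<close> leaves room for the strict
  \<open>< e\<close>.\<close>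

lemma barrier_tendsto_right:
  assumes "f \<longlonglongrightarrow> a"
  shows "(\<lambda>n. H x (f n)) \<longlonglongrightarrow> H x a"
proof (rule tendstoI)
  fix e :: real assume "e > 0"
  then have "\<forall>\<^sub>F n in sequentially. (\<exists>s>0. m s a (f n) < ereal (e/2)) \<and> (\<exists>s>0. m s (f n) a < ereal (e/2))"
    by (intro eventually_compose_filterlim[OF near assms]) simp
  then show "\<forall>\<^sub>F n in sequentially. dist (H x (f n)) (H x a) < e"
  proof eventually_elim
    case (elim n)
    then have "H x (f n) \<le> H x a + e/2" "H x a \<le> H x (f n) + e/2"
      using barrier_step_right by blast+
    with \<open>e > 0\<close> show ?case by (auto simp: dist_real_def)
  qed
qed

lemma barrier_tendsto_left:
  assumes "f \<longlonglongrightarrow> a"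
  shows "(\<lambda>n. H (f n) y) \<longlonglongrightarrow> H a y"
proof (rule tendstoI)
  fix e :: real assume "e > 0"
  then have "\<forall>\<^sub>F n in sequentially. (\<exists>s>0. m s a (f n) < ereal (e/2)) \<and> (\<exists>s>0. m s (f n) a < ereal (e/2))"
    by (intro eventually_compose_filterlim[OF near assms]) simp
  then show "\<forall>\<^sub>F n in sequentially. dist (H (f n) y) (H a y) < e"
  proof eventually_elim
    case (elim n)
    then have "H (f n) y \<le> e/2 + H a y" "H a y \<le> e/2 + H (f n) y"
      using barrier_step_left by blast+
    with \<open>e > 0\<close> show ?case by (auto simp: dist_real_def)
  qed
qed

section \<open>Compactness and the Aubry set\<close>

lemma convergent_subsequence:
  fixes f :: "nat \<Rightarrow> 'm"
  obtains a r where "strict_mono r" "(f \<circ> r) \<longlonglongrightarrow> a"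
  using compact_imp_seq_compact[OF compact_space] unfolding seq_compact_def by (metis UNIV_I)

text \<open>The cut is made at half time because both parts must last arbitrarily long: only then is
  each one comparable with a barrier value. Compactness supplies a limit of the cutting
  points.\<close>

lemma barrier_midpoint:
  obtains a where "H x y = H x a + H a y"
proof -
  have "\<exists>t p a b. real n + 1 \<le> t \<and> m t x p < ereal a \<and> m t p y < ereal b \<and>
      a + b = H x y + 1 / (real n + 1)" for n :: nat
  proof -
    obtain t where t: "2 * (real n + 1) \<le> t" "0 < t" "m t x y < ereal (H x y + 1 / (real n + 1))"
      using frequently_below_barrier[of x y "H x y + 1 / (real n + 1)" "2 * (real n + 1)"] by auto
    then obtain p a b where "m (t/2) x p < ereal a" "m (t/2) p y < ereal b"
        "a + b = H x y + 1 / (real n + 1)"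
      using split[of "t/2" "t/2" x y "H x y + 1 / (real n + 1)"] by auto
    moreover have "real n + 1 \<le> t / 2" using t(1) by simp
    ultimately show ?thesis by blast
  qed
  then obtain t p a b where tp: "\<And>n. real n + 1 \<le> t n" "\<And>n. m (t n) x (p n) < ereal (a n)"
      "\<And>n. m (t n) (p n) y < ereal (b n)" and ab: "\<And>n. a n + b n = H x y + 1 / (real n + 1)"
    by metis
  obtain q r where r: "strict_mono r" "(p \<circ> r) \<longlonglongrightarrow> q" by (rule convergent_subsequence)
  have "H x q + H q y \<le> H x y"
  proof (rule ccontr)
    assume neg: "\<not> ?thesis"
    \<comment> \<open>The 5 counts one \<open>d\<close> for each of the two cheap connections, to
      and from \<open>q\<close>, one for each comparison of a finite-time value with the barrier,
      and one for the vanishing slack.\<close>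
    define d where "d = (H x q + H q y - H x y) / 5"
    have d: "d > 0" "H x q + H q y = H x y + 5 * d" using neg by (auto simp: d_def field_simps)
    obtain T1 where T1: "\<And>t. T1 \<le> t \<Longrightarrow> ereal (H x q - d) < m t x q"
      using eventually_above_barrier[of "H x q - d" x q] d by auto
    obtain T2 where T2: "\<And>t. T2 \<le> t \<Longrightarrow> ereal (H q y - d) < m t q y"
      using eventually_above_barrier[of "H q y - d" q y] d by auto
    have "\<forall>\<^sub>F n in sequentially. (\<exists>s>0. m s q ((p \<circ> r) n) < ereal d) \<and> (\<exists>s>0. m s ((p \<circ> r) n) q < ereal d)"
      using d by (intro eventually_compose_filterlim[OF near r(2)]) simp
    moreover have "\<forall>\<^sub>F n in sequentially. max T1 (max T2 (1 / d)) \<le> real n"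
      using filterlim_real_sequentially unfolding filterlim_at_top by blast
    ultimately have "\<forall>\<^sub>F n in sequentially. False"
    proof eventually_elim
      case (elim n)
      have n: "n \<le> r n" using r(1) by (rule seq_suble)
      then have "1 / d < real (r n) + 1" using elim by linarith
      then have small: "1 / (real (r n) + 1) < d" using d(1) by (simp add: field_simps)
      have large: "real n + 1 \<le> t (r n)" using tp(1)[of "r n"] n by linarith
      from elim obtain s s' where s: "s > 0" "m s (p (r n)) q < ereal d"
        and s': "s' > 0" "m s' q (p (r n)) < ereal d" by auto
      have "ereal (H x q - d) < m (t (r n) + s) x q"
        using s large elim by (intro T1) auto
      also have "\<dots> < ereal (a (r n) + d)"
        using s large tp(2)[of "r n"] by (intro concat) auto
      finally have "H x q - d < a (r n) + d" by simp
      have "ereal (H q y - d) < m (s' + t (r n)) q y"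
        using s' large elim by (intro T2) auto
      also have "\<dots> < ereal (d + b (r n))"
        using s' large tp(3)[of "r n"] by (intro concat) auto
      finally have "H q y - d < d + b (r n)" by simp
      with \<open>H x q - d < a (r n) + d\<close> show False using ab[of "r n"] d small by linarith
    qed
    then show False by simp
  qed
  with barrier_triangle[of x y q] that show thesis by fastforce
qed

text \<open>Iterating the midpoint construction gives points \<open>f n\<close> with
  \<open>H x (f n) = H x (f k) + H (f k) (f n)\<close> for \<open>n < k\<close>, so that \<open>H (f k) (f n) \<rightarrow> 0\<close> along a
  convergent subsequence.\<close>

lemma barrier_through_aubry:
  obtains a where "H a a = 0" "H x y = H x a + H a y"
proof -
  obtain mid where mid: "\<And>z. H x z = H x (mid z) + H (mid z) z"
    by (metis barrier_midpoint)
  define f where "f n = (mid ^^ n) y" for n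
  \<comment> \<open>\<open>j = 0\<close> is excluded: it would assert
    \<open>H (f n) (f n) = 0\<close>, the very property sought for the limit. In the induction step
    the two triangle inequalities give the two directions.\<close>
  have chain: "H x (f n) = H x (f (n + j)) + H (f (n + j)) (f n)" if "j > 0" for n j
    using that
  proof (induction j rule: nat_induct_non_zero)
    case 1
    then show ?case using mid[of "f n"] by (simp add: f_def)
  next
    case (Suc j)
    have "H x (f (n + j)) = H x (f (n + Suc j)) + H (f (n + Suc j)) (f (n + j))"
      using mid[of "f (n + j)"] by (simp add: f_def)
    then show ?case
      using Suc.IH barrier_triangle[of "f (n + Suc j)" "f n" "f (n + j)"]
        barrier_triangle[of x "f n" "f (n + Suc j)"] by simp
  qed
  obtain a r where r: "strict_mono r" "(f \<circ> r) \<longlonglongrightarrow> a" by (rule convergent_subsequence)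
  have chain_r: "H x (f i) = H x ((f \<circ> r) n) + H ((f \<circ> r) n) (f i)" if "i < n" for i n
    using chain[of "r n - i" i] that seq_suble[OF r(1), of n] by simp
  \<comment> \<open>With \<open>i\<close> fixed, the subsequence runs past \<open>i\<close>, and
    continuity of \<open>H\<close> in each argument carries the relation over to the limit
    \<open>a\<close>.\<close>
  have limit: "H x (f i) = H x a + H a (f i)" for i
  proof (rule LIMSEQ_unique)
    show "(\<lambda>n. H x ((f \<circ> r) n) + H ((f \<circ> r) n) (f i)) \<longlonglongrightarrow> H x a + H a (f i)"
      by (intro tendsto_add barrier_tendsto_right barrier_tendsto_left r(2))
    have "\<forall>\<^sub>F n in sequentially. H x (f i) = H x ((f \<circ> r) n) + H ((f \<circ> r) n) (f i)"
      using eventually_gt_at_top[of i] by eventually_elim (rule chain_r)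
    then show "(\<lambda>n. H x ((f \<circ> r) n) + H ((f \<circ> r) n) (f i)) \<longlonglongrightarrow> H x (f i)"
      by (rule tendsto_eventually[OF eventually_mono]) simp
  qed
  \<comment> \<open>Now \<open>i\<close> itself runs through the subsequence in
    \<open>limit\<close>, which forces \<open>H a a = 0\<close>.\<close>
  have "H x a = H x a + H a a"
  proof (rule LIMSEQ_unique)
    show "(\<lambda>n. H x ((f \<circ> r) n)) \<longlonglongrightarrow> H x a" by (intro barrier_tendsto_right r(2))
    show "(\<lambda>n. H x ((f \<circ> r) n)) \<longlonglongrightarrow> H x a + H a a"
      using tendsto_add[OF tendsto_const[of "H x a"] barrier_tendsto_right[OF r(2), of a]]
      by (simp add: limit)
  qed
  moreover have "H x y = H x a + H a y" using limit[of 0] by (simp add: f_def)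
  ultimately show thesis using that by simp
qed

section \<open>Static classes and singular points\<close>

text \<open>Going from \<open>a\<close> to \<open>b\<close> and back costs nothing in total, which
  turns the triangle inequality through \<open>a\<close> into an equality. Hence the functions
  \<open>H a\<close> and \<open>H b\<close> differ by the constant \<open>H b a\<close>.\<close>

lemma barrier_static_eq:
  assumes "H a b + H b a = 0"
  shows "H b z = H b a + H a z"
  using barrier_triangle[of b z a] barrier_triangle[of a z b] assms by simp

text \<open>It suffices to give each element of a superdifferential a companion different from it.
  An empty superdifferential counts as singular by the definition of \<open>Sing_c\<close>.\<close>

lemma Sing_barrier_eq_UNIV:
  assumes nontrivial: "\<forall>C\<in>static_classes (\<lambda>x y. ereal (H x y)). \<not> is_singleton C"
  shows "Sing_c (\<lambda>x y. ereal (H x y)) u = UNIV"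
proof -
  have mem: "x \<in> c_superdifferential (\<lambda>x y. ereal (H x y)) u y \<longleftrightarrow>
      (\<forall>z. u z - H x z \<le> u y - H x y)" for x y
    by (simp add: c_superdifferential_def)
  have "\<exists>x'\<in>c_superdifferential (\<lambda>x y. ereal (H x y)) u y. x' \<noteq> x"
    if x: "x \<in> c_superdifferential (\<lambda>x y. ereal (H x y)) u y" for x y
  proof -
    obtain a where a: "H a a = 0" "H x y = H x a + H a y" by (rule barrier_through_aubry)
    \<comment> \<open>The maximum property of \<open>x\<close> combines with the triangle inequality
      through \<open>a\<close>; the term \<open>H x a\<close> cancels because the decomposition of
      \<open>H x y\<close> is exact.\<close>
    have "u z - H a z \<le> u y - H a y" for z
      using x[unfolded mem, rule_format, of z] a(2) barrier_triangle[of x z a] by simp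
    then have a_mem: "a \<in> c_superdifferential (\<lambda>x y. ereal (H x y)) u y" by (simp add: mem)
    show ?thesis
    proof (cases "a = x")
      case True
      \<comment> \<open>Here \<open>H x x = 0\<close>, so \<open>?C\<close> is the static class of
        \<open>x\<close> written out.\<close>
      let ?C = "{b. H b b = 0 \<and> H x b + H b x = 0}"
      have "?C \<in> static_classes (\<lambda>x y. ereal (H x y))"
        unfolding static_classes_def quotient_def projected_aubry_set_def
        using a True by (auto simp: zero_ereal_def intro!: exI[of _ x])
      with nontrivial have "?C \<noteq> {x}" by (metis is_singletonI)
      moreover have "x \<in> ?C" using a True by simp
      ultimately have "\<exists>b\<in>?C. b \<noteq> x" by blast
      then obtain b where b: "b \<noteq> x" "H x b + H b x = 0" by blast
      \<comment> \<open>Subtracting \<open>H b\<close> or \<open>H x\<close> from \<open>u\<close>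
        gives functions that differ by a constant, so they have the same maximum points.\<close>
      have "b \<in> c_superdifferential (\<lambda>x y. ereal (H x y)) u y"
        unfolding mem
      proof
        fix z
        show "u z - H b z \<le> u y - H b y"
          using x[unfolded mem, rule_format, of z] barrier_static_eq[OF b(2), of z]
            barrier_static_eq[OF b(2), of y] by linarith
      qed
      with b show ?thesis by blast
    qed (use a_mem in blast)
  qed
  then have "\<not> is_singleton (c_superdifferential (\<lambda>x y. ereal (H x y)) u y)" for y
    by (metis is_singleton_def singletonD singletonI)
  then show ?thesis by (auto simp: Sing_c_def)
qed

end

section \<open>Application to the Peierls barrier\<close>

theorem corollary3p16:
  fixes A :: "('m::{t2_space, second_countable_topology}, 'e::euclidean_space) chart set"
    and g :: "'m \<Rightarrow> ('m, 'e) tangent \<Rightarrow> ('m, 'e) tangent \<Rightarrow> real"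
    and L :: "'m \<Rightarrow> ('m, 'e) tangent \<Rightarrow> real"
    and u :: "'m \<Rightarrow> real"
  assumes "closed_connected_manifold A"
    and "riemannian_metric A g"
    and "tonelli_lagrangian A g L"
    and "is_mane_critical_value A L 0"
    and "weak_KAM_solution A L u"
    and "\<forall>C\<in>static_classes (peierls_barrier A L 0). \<not> is_singleton C"
  shows "Sing_c (peierls_barrier A L 0) u = UNIV"
proof -
  let ?h = "peierls_barrier A L 0"
  define H where "H x y = real_of_ereal (?h x y)" for x y
  \<comment> \<open>The characterization of the critical value, taken at 0 itself, is finiteness of
    the barrier, so \<open>real_of_ereal\<close> loses nothing.\<close>
  have "\<bar>?h x y\<bar> \<noteq> \<infinity>" for x y
    using assms(4)[unfolded is_mane_critical_value_def, THEN spec, of 0] by simp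
  then have H: "?h = (\<lambda>x y. ereal (H x y))" by (simp add: H_def fun_eq_iff ereal_real)
  have atlas: "smooth_atlas A" and compact: "compact (UNIV :: 'm set)"
    using assms(1) by (simp_all add: closed_connected_manifold_def)
  interpret action_barrier "minimal_action A L" H
  proof
    \<comment> \<open>For critical value 0 the added term in the barrier vanishes, leaving the lower
      limit of the minimal action.\<close>
    show "ereal (H x y) = Liminf at_top (\<lambda>t. minimal_action A L t x y)" for x y
      using H by (simp add: fun_eq_iff peierls_barrier_def zero_ereal_def[symmetric])
  qed (fact compact minimal_action_concat minimal_action_split
      minimal_action_eventually_small[OF atlas assms(3)])+
  show ?thesis
    unfolding H using assms(6) by (intro Sing_barrier_eq_UNIV) (simp add: H)
qed

end
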